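(* (1) Let $(A,\cdot,P_{\Omega},p)$ be a matching Hom-associative Rota-Baxter algebra of weight $0$. Assume that $p \circ P_{\omega}=P_{\omega} \circ p$ for each $\omega \in \Omega$. Define the operations $\prec_{\omega}$ and $\succ_{\omega}$ for $\omega \in \Omega$ by $$x \prec_{\omega} y := x \cdot P_{\omega}(y) \quad \text{and} \quad x \succ_{\omega} y := P_{\omega}(x)\cdot y, \quad \text{for } x,y \in A.$$ Then $(A, \prec_{\Omega}, \succ_{\Omega},p)$ is a matching Hom-dendriform algebra. (2) Let $(A, \cdot, P_{\Omega},p)$ be a matching Hom-associative Rota-Baxter algebra of weight $\lambda_\Omega=(\lambda_\omega)_{\omega\in\Omega}$. Assume that $p \circ P_{\omega} =P_{\omega} \circ p$ for each $\omega \in \Omega$. Define the operations $\prec_{\omega}$, $\succ_{\omega}$, $\omega \in \Omega$, by $$x \prec_{\omega} y := x \cdot P_{\omega}(y) + \lambda_{\omega}\, x \cdot y \quad \text{and} \quad x \succ_{\omega} y := P_{\omega}(x) \cdot y, \quad \text{for } x,y \in A.$$ Then $(A,\prec_{\Omega}, \succ_{\Omega},p)$ is a matching Hom-dendriform algebra.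
   Context: Let $\mathbf{k}$ be a unitary commutative ring, the base ring of all modules and linear maps, and let $\Omega$ be a nonempty set; a subscript $\Omega$ denotes a family indexed by $\Omega$. Let $\lambda_{\Omega}=(\lambda_{\omega})_{\omega\in \Omega}$ be a family of scalars in $\mathbf{k}$. A Hom-associative algebra is a triple $(A,\cdot,p)$ with $A$ a $\mathbf{k}$-module, $\cdot:A\otimes A\to A$ bilinear and $p:A\to A$ linear, such that $(x\cdot y)\cdot p(z)=p(x)\cdot(y\cdot z)$ for all $x,y,z\in A$. A matching Hom-associative Rota-Baxter algebra of weight $\lambda_\Omega$ is a quadruple $(A,\cdot,P_\Omega,p)$ where $(A,\cdot,p)$ is a Hom-associative algebra and $P_\Omega=(P_\omega)_{\omega\in\Omega}$ is a family of linear operators $P_\omega:A\to A$ satisfying the matching Rota-Baxter equation $$P_{\alpha}(x) \cdot P_{\beta}(y)=P_{\alpha}(x \cdot P_{\beta}(y))+P_{\beta}(P_{\alpha}(x) \cdot y)+ \lambda_{\beta}P_{\alpha}(x \cdot y)\quad\text{for all } x,y \in A,\ \alpha, \beta \in \Omega.$$ It is of weight $0$ if $\lambda_\omega=0$ for all $\omega\in\Omega$. A matching Hom-dendriform algebra $(A,\prec_\Omega,\succ_\Omega,p)$ is a $\mathbf{k}$-module $A$ with bilinear operations $\prec_\omega,\succ_\omega: A\otimes A\to A$ ($\omega\in\Omega$) and a linear map $p:A\to A$ such that for all $x,y,z\in A$, $\alpha,\beta\in\Omega$: $$(x \prec_{\alpha} y) \prec_{\beta} p(z)= p(x) \prec_{\alpha}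 (y \prec_{\beta} z)+ p(x) \prec_{\beta} (y \succ_{\alpha} z),$$ $$(x \succ_{\alpha} y) \prec_{\beta} p(z)= p(x) \succ_{\alpha} (y \prec_{\beta} z),$$ $$(x \prec_{\beta} y) \succ_{\alpha} p(z)+ (x \succ_{\alpha} y) \succ_{\beta} p(z) = p(x) \succ_{\alpha} (y \succ_{\beta} z).$$ *)

theory Defs
  imports "HOL-Algebra.Module"
begin

text \<open>
  All structures live on the carrier of a module \<open>M\<close> over a commutative ring \<open>R\<close>. The product of a
  Hom-associative algebra is a separate parameter: the multiplication and unit that the record type
  of \<open>M\<close> inherits from rings are never used.
\<close>

definition linear_map :: "('a, 'm) ring_scheme \<Rightarrow> ('a, 'b, 'n) module_scheme \<Rightarrow> ('b \<Rightarrow> 'b) \<Rightarrow> bool"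
  where "linear_map R M f \<longleftrightarrow>
    f \<in> carrier M \<rightarrow> carrier M \<and>
    (\<forall>x\<in>carrier M. \<forall>y\<in>carrier M. f (x \<oplus>\<^bsub>M\<^esub> y) = f x \<oplus>\<^bsub>M\<^esub> f y) \<and>
    (\<forall>a\<in>carrier R. \<forall>x\<in>carrier M. f (a \<odot>\<^bsub>M\<^esub> x) = a \<odot>\<^bsub>M\<^esub> f x)"

definition bilinear_op :: "('a, 'm) ring_scheme \<Rightarrow> ('a, 'b, 'n) module_scheme \<Rightarrow> ('b \<Rightarrow> 'b \<Rightarrow> 'b) \<Rightarrow> bool"
  where "bilinear_op R M b \<longleftrightarrow>
    (\<forall>x\<in>carrier M. linear_map R M (\<lambda>y. b x y)) \<and>
    (\<forall>y\<in>carrier M. linear_map R M (\<lambda>x. b x y))"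

locale hom_associative_algebra = module R M
  for R :: "('a, 'm) ring_scheme" (structure) and M :: "('a, 'b, 'n) module_scheme" (structure) +
  fixes mul :: "'b \<Rightarrow> 'b \<Rightarrow> 'b" (infixl "\<cdot>" 70)
    and p :: "'b \<Rightarrow> 'b"
  assumes mul_bilinear: "bilinear_op R M mul"
    and p_linear: "linear_map R M p"
    and hom_assoc: "\<lbrakk>x \<in> carrier M; y \<in> carrier M; z \<in> carrier M\<rbrakk>
      \<Longrightarrow> (x \<cdot> y) \<cdot> p z = p x \<cdot> (y \<cdot> z)"

locale matching_hom_assoc_rota_baxter = hom_associative_algebra R M mul p
  for R :: "('a, 'm) ring_scheme" (structure) and M :: "('a, 'b, 'n) module_scheme" (structure)
    and \<Omega> :: "'i set" and lam :: "'i \<Rightarrow> 'a"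
    and mul :: "'b \<Rightarrow> 'b \<Rightarrow> 'b" (infixl "\<cdot>" 70)
    and P :: "'i \<Rightarrow> 'b \<Rightarrow> 'b" and p :: "'b \<Rightarrow> 'b" +
  assumes index_nonempty: "\<Omega> \<noteq> {}"
    and weight_closed: "\<omega> \<in> \<Omega> \<Longrightarrow> lam \<omega> \<in> carrier R"
    and P_linear: "\<omega> \<in> \<Omega> \<Longrightarrow> linear_map R M (P \<omega>)"
    and rota_baxter: "\<lbrakk>\<alpha> \<in> \<Omega>; \<beta> \<in> \<Omega>; x \<in> carrier M; y \<in> carrier M\<rbrakk>
      \<Longrightarrow> P \<alpha> x \<cdot> P \<beta> y =
        P \<alpha> (x \<cdot> P \<beta> y) \<oplus>\<^bsub>M\<^esub> P \<beta> (P \<alpha> x \<cdot> y) \<oplus>\<^bsub>M\<^esub> lam \<beta> \<odot>\<^bsub>M\<^esub> P \<alpha> (x \<cdot> y)"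

locale matching_hom_dendriform = module R M
  for R :: "('a, 'm) ring_scheme" (structure) and M :: "('a, 'b, 'n) module_scheme" (structure) +
  fixes \<Omega> :: "'i set"
    and prec succ :: "'i \<Rightarrow> 'b \<Rightarrow> 'b \<Rightarrow> 'b"
    and p :: "'b \<Rightarrow> 'b"
  assumes index_nonempty: "\<Omega> \<noteq> {}"
    and prec_bilinear: "\<omega> \<in> \<Omega> \<Longrightarrow> bilinear_op R M (prec \<omega>)"
    and succ_bilinear: "\<omega> \<in> \<Omega> \<Longrightarrow> bilinear_op R M (succ \<omega>)"
    and p_linear: "linear_map R M p"
    and dendriform_prec_prec:
      "\<lbrakk>\<alpha> \<in> \<Omega>; \<beta> \<in> \<Omega>; x \<in> carrier M; y \<in> carrier M; z \<in> carrier M\<rbrakk>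
        \<Longrightarrow> prec \<beta> (prec \<alpha> x y) (p z) =
          prec \<alpha> (p x) (prec \<beta> y z) \<oplus>\<^bsub>M\<^esub> prec \<beta> (p x) (succ \<alpha> y z)"
    and dendriform_succ_prec:
      "\<lbrakk>\<alpha> \<in> \<Omega>; \<beta> \<in> \<Omega>; x \<in> carrier M; y \<in> carrier M; z \<in> carrier M\<rbrakk>
        \<Longrightarrow> prec \<beta> (succ \<alpha> x y) (p z) = succ \<alpha> (p x) (prec \<beta> y z)"
    and dendriform_succ_succ:
      "\<lbrakk>\<alpha> \<in> \<Omega>; \<beta> \<in> \<Omega>; x \<in> carrier M; y \<in> carrier M; z \<in> carrier M\<rbrakk>
        \<Longrightarrow> succ \<alpha> (prec \<beta> x y) (p z) \<oplus>\<^bsub>M\<^esub> succ \<beta> (succ \<alpha> x y) (p z) =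
          succ \<alpha> (p x) (succ \<beta> y z)"

end

theory Submission
  imports Defs
begin

text \<open>
  The whole proposition rests on one reading of the matching Rota-Baxter equation. With
  \<open>x \<prec>\<^sub>\<omega> y = x \<cdot> P\<^sub>\<omega> y + \<lambda>\<^sub>\<omega> (x \<cdot> y)\<close> and \<open>x \<succ>\<^sub>\<omega> y = P\<^sub>\<omega> x \<cdot> y\<close>, linearity of \<open>P\<^sub>\<alpha>\<close> lets the weight
  term be absorbed, and the equation becomes
  \<open>P\<^sub>\<alpha> x \<cdot> P\<^sub>\<beta> y = P\<^sub>\<alpha> (x \<prec>\<^sub>\<beta> y) + P\<^sub>\<beta> (x \<succ>\<^sub>\<alpha> y)\<close> (lemma \<open>rota_baxter_split\<close>).
  Since \<open>p\<close> commutes with every \<open>P\<^sub>\<omega>\<close>, Hom-associativity also applies to products whose last factor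
  is \<open>P\<^sub>\<omega> (p z)\<close> or whose first factor is \<open>P\<^sub>\<omega> (p x)\<close>. The middle dendriform axiom is such a
  rebracketing, term by term. In the other two, rebracketing reaches a product
  \<open>P\<^sub>\<alpha> _ \<cdot> P\<^sub>\<beta> _\<close> of two neighbours, and its two summands in the split form are what makes
  one side of the axiom a sum of two dendriform products.

  The operations of weight zero agree with the weighted ones only for arguments in the carrier.
  The dendriform axioms do not look beyond the carrier (lemma \<open>matching_hom_dendriform_cong\<close>),
  so the weight-zero case is a specialisation of the weighted one.
\<close>

section \<open>Linear and bilinear maps on a carrier\<close>

lemma linear_map_closed: "linear_map R M f \<Longrightarrow> x \<in> carrier M \<Longrightarrow> f x \<in> carrier M"
  by (auto simp: linear_map_def)

lemma linear_map_add:
  "linear_map R M f \<Longrightarrow> x \<in> carrier M \<Longrightarrow> y \<in> carrier M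
    \<Longrightarrow> f (x \<oplus>\<^bsub>M\<^esub> y) = f x \<oplus>\<^bsub>M\<^esub> f y"
  by (auto simp: linear_map_def)

lemma linear_map_smult:
  "linear_map R M f \<Longrightarrow> a \<in> carrier R \<Longrightarrow> x \<in> carrier M
    \<Longrightarrow> f (a \<odot>\<^bsub>M\<^esub> x) = a \<odot>\<^bsub>M\<^esub> f x"
  by (auto simp: linear_map_def)

lemma linear_map_compose:
  "linear_map R M f \<Longrightarrow> linear_map R M g \<Longrightarrow> linear_map R M (\<lambda>x. f (g x))"
  by (auto simp: linear_map_def Pi_iff)

lemma bilinear_op_left: "bilinear_op R M b \<Longrightarrow> y \<in> carrier M \<Longrightarrow> linear_map R M (\<lambda>x. b x y)"
  by (auto simp: bilinear_op_def)

lemma bilinear_op_right: "bilinear_op R M b \<Longrightarrow> x \<in> carrier M \<Longrightarrow> linear_map R M (b x)"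
  by (auto simp: bilinear_op_def)

lemma bilinear_op_closed:
  "bilinear_op R M b \<Longrightarrow> x \<in> carrier M \<Longrightarrow> y \<in> carrier M \<Longrightarrow> b x y \<in> carrier M"
  using linear_map_closed[OF bilinear_op_right] .

lemma bilinear_op_compose_left:
  "bilinear_op R M b \<Longrightarrow> linear_map R M f \<Longrightarrow> bilinear_op R M (\<lambda>x y. b (f x) y)"
  unfolding bilinear_op_def
  using linear_map_compose[of R M "\<lambda>x. b x y" f for y] by (simp add: linear_map_closed)

lemma bilinear_op_compose_right:
  "bilinear_op R M b \<Longrightarrow> linear_map R M f \<Longrightarrow> bilinear_op R M (\<lambda>x y. b x (f y))"
  unfolding bilinear_op_def
  using linear_map_compose[of R M "b x" f for x] by (simp add: linear_map_closed)

context module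
begin

lemma linear_map_cong:
  assumes "linear_map R M f" and "\<And>x. x \<in> carrier M \<Longrightarrow> g x = f x"
  shows "linear_map R M g"
  using assms by (auto simp: linear_map_def Pi_iff)

lemma bilinear_op_cong:
  assumes "bilinear_op R M b"
    and "\<And>x y. x \<in> carrier M \<Longrightarrow> y \<in> carrier M \<Longrightarrow> c x y = b x y"
  shows "bilinear_op R M c"
  using assms unfolding bilinear_op_def by (auto intro: linear_map_cong)

lemma linear_map_sum:
  assumes f: "linear_map R M f" and g: "linear_map R M g"
  shows "linear_map R M (\<lambda>x. f x \<oplus>\<^bsub>M\<^esub> g x)"
  unfolding linear_map_def
  using linear_map_closed[OF f] linear_map_closed[OF g]
  by (simp add: linear_map_add[OF f] linear_map_add[OF g] linear_map_smult[OF f]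
      linear_map_smult[OF g] smult_r_distr M.a_ac)

lemma linear_map_scaled:
  assumes f: "linear_map R M f" and a: "a \<in> carrier R"
  shows "linear_map R M (\<lambda>x. a \<odot>\<^bsub>M\<^esub> f x)"
  unfolding linear_map_def
  using linear_map_closed[OF f] a
  by (simp add: linear_map_add[OF f] linear_map_smult[OF f] smult_r_distr
      smult_assoc1[symmetric] R.m_comm)

lemma bilinear_op_sum:
  "bilinear_op R M b \<Longrightarrow> bilinear_op R M c \<Longrightarrow> bilinear_op R M (\<lambda>x y. b x y \<oplus>\<^bsub>M\<^esub> c x y)"
  unfolding bilinear_op_def by (auto intro: linear_map_sum)

lemma bilinear_op_scaled:
  "bilinear_op R M b \<Longrightarrow> a \<in> carrier R \<Longrightarrow> bilinear_op R M (\<lambda>x y. a \<odot>\<^bsub>M\<^esub> b x y)"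
  unfolding bilinear_op_def by (auto intro: linear_map_scaled)

end

section \<open>Dependence of dendriform structures on the carrier\<close>

text \<open>
  Every term in the axioms is built from carrier elements by maps that preserve the carrier, so
  only the values there matter.
\<close>

lemma matching_hom_dendriform_cong:
  assumes dend: "matching_hom_dendriform R M \<Omega> prec succ p"
    and prec: "\<And>\<omega> x y. \<omega> \<in> \<Omega> \<Longrightarrow> x \<in> carrier M \<Longrightarrow> y \<in> carrier M \<Longrightarrow> prec' \<omega> x y = prec \<omega> x y"
  shows "matching_hom_dendriform R M \<Omega> prec' succ p"
proof -
  interpret D: matching_hom_dendriform R M \<Omega> prec succ p by (fact dend)
  note closed = bilinear_op_closed[OF D.prec_bilinear] bilinear_op_closed[OF D.succ_bilinear]
    linear_map_closed[OF D.p_linear]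
  show ?thesis
  proof
    show "\<Omega> \<noteq> {}" by (fact D.index_nonempty)
    show "bilinear_op R M (prec' \<omega>)" if "\<omega> \<in> \<Omega>" for \<omega>
      using D.bilinear_op_cong[OF D.prec_bilinear[OF that]] prec[OF that] .
  qed (simp_all add: prec closed D.succ_bilinear D.p_linear D.dendriform_prec_prec
      D.dendriform_succ_prec D.dendriform_succ_succ)
qed

section \<open>The dendriform structure of a matching Rota-Baxter algebra\<close>

context matching_hom_assoc_rota_baxter
begin

lemmas mul_closed = bilinear_op_closed[OF mul_bilinear]
lemmas mul_add_left = linear_map_add[OF bilinear_op_left[OF mul_bilinear]]
lemmas mul_add_right = linear_map_add[OF bilinear_op_right[OF mul_bilinear]]
lemmas mul_smult_left = linear_map_smult[OF bilinear_op_left[OF mul_bilinear]]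
lemmas mul_smult_right = linear_map_smult[OF bilinear_op_right[OF mul_bilinear]]
lemmas p_closed = linear_map_closed[OF p_linear]
lemmas P_closed = linear_map_closed[OF P_linear]
lemmas P_add = linear_map_add[OF P_linear]
lemmas P_smult = linear_map_smult[OF P_linear]

lemmas closed = mul_closed p_closed P_closed weight_closed
lemmas mul_distribs = mul_add_left mul_add_right mul_smult_left mul_smult_right

text \<open>
  The weight term is \<open>P \<alpha>\<close> of something, so it joins the first summand of the Rota-Baxter equation;
  this dictates that \<open>\<prec>\<close>, and not \<open>\<succ>\<close>, carries the weight.
\<close>

lemma rota_baxter_split:
  assumes "\<alpha> \<in> \<Omega>" "\<beta> \<in> \<Omega>" "x \<in> carrier M" "y \<in> carrier M"
  shows "P \<alpha> x \<cdot> P \<beta> y =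
    P \<alpha> (x \<cdot> P \<beta> y \<oplus>\<^bsub>M\<^esub> lam \<beta> \<odot>\<^bsub>M\<^esub> (x \<cdot> y)) \<oplus>\<^bsub>M\<^esub> P \<beta> (P \<alpha> x \<cdot> y)"
  using assms by (simp add: rota_baxter P_add P_smult closed M.a_ac)

lemma weighted_prec_bilinear:
  assumes "\<omega> \<in> \<Omega>"
  shows "bilinear_op R M (\<lambda>x y. x \<cdot> P \<omega> y \<oplus>\<^bsub>M\<^esub> lam \<omega> \<odot>\<^bsub>M\<^esub> (x \<cdot> y))"
  using bilinear_op_sum[OF bilinear_op_compose_right[OF mul_bilinear P_linear[OF assms]]
      bilinear_op_scaled[OF mul_bilinear weight_closed[OF assms]]] .

lemma hom_assoc_P_last:
  assumes "\<omega> \<in> \<Omega>" "x \<in> carrier M" "y \<in> carrier M" "z \<in> carrier M"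
    and "p (P \<omega> z) = P \<omega> (p z)"
  shows "(x \<cdot> y) \<cdot> P \<omega> (p z) = p x \<cdot> (y \<cdot> P \<omega> z)"
  using hom_assoc[of x y "P \<omega> z"] assms by (simp add: closed)

lemma hom_assoc_P_first:
  assumes "\<omega> \<in> \<Omega>" "x \<in> carrier M" "y \<in> carrier M" "z \<in> carrier M"
    and "p (P \<omega> x) = P \<omega> (p x)"
  shows "(P \<omega> x \<cdot> y) \<cdot> p z = P \<omega> (p x) \<cdot> (y \<cdot> z)"
  using hom_assoc[of "P \<omega> x" y z] assms by (simp add: closed)

theorem weighted_matching_hom_dendriform:
  assumes commute: "\<And>\<omega> x. \<omega> \<in> \<Omega> \<Longrightarrow> x \<in> carrier M \<Longrightarrow> p (P \<omega> x) = P \<omega> (p x)"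
  shows "matching_hom_dendriform R M \<Omega>
    (\<lambda>\<omega> x y. x \<cdot> P \<omega> y \<oplus>\<^bsub>M\<^esub> lam \<omega> \<odot>\<^bsub>M\<^esub> (x \<cdot> y)) (\<lambda>\<omega> x y. P \<omega> x \<cdot> y) p"
proof
  show "\<Omega> \<noteq> {}" by (fact index_nonempty)
  show "linear_map R M p" by (fact p_linear)
  fix \<omega> assume "\<omega> \<in> \<Omega>"
  then show "bilinear_op R M (\<lambda>x y. x \<cdot> P \<omega> y \<oplus>\<^bsub>M\<^esub> lam \<omega> \<odot>\<^bsub>M\<^esub> (x \<cdot> y))"
    and "bilinear_op R M (\<lambda>x y. P \<omega> x \<cdot> y)"
    by (simp_all add: weighted_prec_bilinear bilinear_op_compose_left[OF mul_bilinear P_linear])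
next
  fix \<alpha> \<beta> x y z
  assume idx: "\<alpha> \<in> \<Omega>" "\<beta> \<in> \<Omega>" and car: "x \<in> carrier M" "y \<in> carrier M" "z \<in> carrier M"
  note known = idx car closed
  let ?u = "x \<cdot> P \<alpha> y \<oplus>\<^bsub>M\<^esub> lam \<alpha> \<odot>\<^bsub>M\<^esub> (x \<cdot> y)"
  let ?v = "y \<cdot> P \<beta> z \<oplus>\<^bsub>M\<^esub> lam \<beta> \<odot>\<^bsub>M\<^esub> (y \<cdot> z)"
  \<comment> \<open>Rebracketing leaves the single Rota-Baxter product \<open>P \<alpha> y \<cdot> P \<beta> z\<close> under \<open>p x\<close>;
    the three terms with a weight in front already match.\<close>
  have "?u \<cdot> P \<beta> (p z) \<oplus>\<^bsub>M\<^esub> lam \<beta> \<odot>\<^bsub>M\<^esub> (?u \<cdot> p z)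
      = p x \<cdot> (P \<alpha> y \<cdot> P \<beta> z) \<oplus>\<^bsub>M\<^esub> lam \<alpha> \<odot>\<^bsub>M\<^esub> (p x \<cdot> (y \<cdot> P \<beta> z)) \<oplus>\<^bsub>M\<^esub>
        (lam \<beta> \<odot>\<^bsub>M\<^esub> (p x \<cdot> (P \<alpha> y \<cdot> z)) \<oplus>\<^bsub>M\<^esub>
         lam \<beta> \<odot>\<^bsub>M\<^esub> (lam \<alpha> \<odot>\<^bsub>M\<^esub> (p x \<cdot> (y \<cdot> z))))"
    by (simp add: known mul_distribs smult_r_distr hom_assoc hom_assoc_P_last commute)
  also have "\<dots> = (p x \<cdot> P \<alpha> ?v \<oplus>\<^bsub>M\<^esub> lam \<alpha> \<odot>\<^bsub>M\<^esub> (p x \<cdot> ?v)) \<oplus>\<^bsub>M\<^esub>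
      (p x \<cdot> P \<beta> (P \<alpha> y \<cdot> z) \<oplus>\<^bsub>M\<^esub> lam \<beta> \<odot>\<^bsub>M\<^esub> (p x \<cdot> (P \<alpha> y \<cdot> z)))"
  proof -
    have "lam \<beta> \<odot>\<^bsub>M\<^esub> (lam \<alpha> \<odot>\<^bsub>M\<^esub> w) = lam \<alpha> \<odot>\<^bsub>M\<^esub> (lam \<beta> \<odot>\<^bsub>M\<^esub> w)"
      if "w \<in> carrier M" for w
      using that idx by (simp add: smult_assoc1[symmetric] weight_closed R.m_comm)
    moreover have "p x \<cdot> (P \<alpha> y \<cdot> P \<beta> z) = p x \<cdot> P \<alpha> ?v \<oplus>\<^bsub>M\<^esub> p x \<cdot> P \<beta> (P \<alpha> y \<cdot> z)"
      by (simp add: rota_baxter_split known mul_add_right)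
    moreover have "p x \<cdot> ?v = p x \<cdot> (y \<cdot> P \<beta> z) \<oplus>\<^bsub>M\<^esub> lam \<beta> \<odot>\<^bsub>M\<^esub> (p x \<cdot> (y \<cdot> z))"
      by (simp add: known mul_distribs)
    moreover have "P \<alpha> ?v \<in> carrier M" by (simp add: known)
    ultimately show ?thesis
      by (simp add: known smult_r_distr M.a_ac)
  qed
  finally show "?u \<cdot> P \<beta> (p z) \<oplus>\<^bsub>M\<^esub> lam \<beta> \<odot>\<^bsub>M\<^esub> (?u \<cdot> p z) =
      (p x \<cdot> P \<alpha> ?v \<oplus>\<^bsub>M\<^esub> lam \<alpha> \<odot>\<^bsub>M\<^esub> (p x \<cdot> ?v)) \<oplus>\<^bsub>M\<^esub>
      (p x \<cdot> P \<beta> (P \<alpha> y \<cdot> z) \<oplus>\<^bsub>M\<^esub> lam \<beta> \<odot>\<^bsub>M\<^esub> (p x \<cdot> (P \<alpha> y \<cdot> z)))" .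
  show "(P \<alpha> x \<cdot> y) \<cdot> P \<beta> (p z) \<oplus>\<^bsub>M\<^esub> lam \<beta> \<odot>\<^bsub>M\<^esub> ((P \<alpha> x \<cdot> y) \<cdot> p z) = P \<alpha> (p x) \<cdot> ?v"
    by (simp add: known mul_distribs hom_assoc_P_last hom_assoc_P_first commute)
  let ?w = "x \<cdot> P \<beta> y \<oplus>\<^bsub>M\<^esub> lam \<beta> \<odot>\<^bsub>M\<^esub> (x \<cdot> y)"
  have "P \<alpha> ?w \<cdot> p z \<oplus>\<^bsub>M\<^esub> P \<beta> (P \<alpha> x \<cdot> y) \<cdot> p z = (P \<alpha> x \<cdot> P \<beta> y) \<cdot> p z"
    by (simp add: rota_baxter_split known mul_add_left)
  also have "\<dots> = P \<alpha> (p x) \<cdot> (P \<beta> y \<cdot> z)"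
    by (simp add: known hom_assoc_P_first commute)
  finally show "P \<alpha> ?w \<cdot> p z \<oplus>\<^bsub>M\<^esub> P \<beta> (P \<alpha> x \<cdot> y) \<cdot> p z = P \<alpha> (p x) \<cdot> (P \<beta> y \<cdot> z)" .
qed

end

theorem proposition4p8:
  fixes R :: "('a, 'm) ring_scheme" and M :: "('a, 'b, 'n) module_scheme"
    and \<Omega> :: "'i set" and lam :: "'i \<Rightarrow> 'a"
    and mul :: "'b \<Rightarrow> 'b \<Rightarrow> 'b" (infixl "\<cdot>" 70)
    and P :: "'i \<Rightarrow> 'b \<Rightarrow> 'b" and p :: "'b \<Rightarrow> 'b"
  shows "(matching_hom_assoc_rota_baxter R M \<Omega> lam mul P p \<and>
          (\<forall>\<omega>\<in>\<Omega>. lam \<omega> = \<zero>\<^bsub>R\<^esub>) \<and>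
          (\<forall>\<omega>\<in>\<Omega>. \<forall>x\<in>carrier M. p (P \<omega> x) = P \<omega> (p x))
          \<longrightarrow> matching_hom_dendriform R M \<Omega>
                (\<lambda>\<omega> x y. x \<cdot> P \<omega> y)
                (\<lambda>\<omega> x y. P \<omega> x \<cdot> y) p)
       \<and> (matching_hom_assoc_rota_baxter R M \<Omega> lam mul P p \<and>
          (\<forall>\<omega>\<in>\<Omega>. \<forall>x\<in>carrier M. p (P \<omega> x) = P \<omega> (p x))
          \<longrightarrow> matching_hom_dendriform R M \<Omega>
                (\<lambda>\<omega> x y. x \<cdot> P \<omega> y \<oplus>\<^bsub>M\<^esub> lam \<omega> \<odot>\<^bsub>M\<^esub> (x \<cdot> y))
                (\<lambda>\<omega> x y. P \<omega> x \<cdot> y) p)"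
proof (intro conjI impI; elim conjE)
  assume "matching_hom_assoc_rota_baxter R M \<Omega> lam mul P p"
    and commute: "\<forall>\<omega>\<in>\<Omega>. \<forall>x\<in>carrier M. p (P \<omega> x) = P \<omega> (p x)"
  then interpret matching_hom_assoc_rota_baxter R M \<Omega> lam mul P p by simp
  have weighted: "matching_hom_dendriform R M \<Omega>
      (\<lambda>\<omega> x y. x \<cdot> P \<omega> y \<oplus>\<^bsub>M\<^esub> lam \<omega> \<odot>\<^bsub>M\<^esub> (x \<cdot> y)) (\<lambda>\<omega> x y. P \<omega> x \<cdot> y) p"
    using commute by (intro weighted_matching_hom_dendriform) blast
  then show "matching_hom_dendriform R M \<Omega>
      (\<lambda>\<omega> x y. x \<cdot> P \<omega> y \<oplus>\<^bsub>M\<^esub> lam \<omega> \<odot>\<^bsub>M\<^esub> (x \<cdot> y)) (\<lambda>\<omega> x y. P \<omega> x \<cdot> y) p" .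
  assume "\<forall>\<omega>\<in>\<Omega>. lam \<omega> = \<zero>\<^bsub>R\<^esub>"
  then show "matching_hom_dendriform R M \<Omega> (\<lambda>\<omega> x y. x \<cdot> P \<omega> y) (\<lambda>\<omega> x y. P \<omega> x \<cdot> y) p"
    by (intro matching_hom_dendriform_cong[OF weighted]) (simp add: closed)
qed

end
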